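(* Let $s,m,\ell$ be integers with $s\ge 2$, $m\ge 0$ and $\ell\in\{1,\ldots,s\}$, and put $n=sm+s-\ell$. Suppose that $\mathcal F_1,\ldots,\mathcal F_s\subset 2^{[n]}$ are cross-dependent. Then $$\sum_{i=1}^s|\mathcal F_i|\le (\ell-1)\binom{n}{m}+s\sum_{t\ge m+1}\binom{n}{t}.$$
   Context: $[n]=\{1,\ldots,n\}$ and $2^{[n]}$ is its power set. Families $\mathcal F_1,\ldots,\mathcal F_s\subset 2^{[n]}$ are called cross-dependent if there is no choice of $F_1\in\mathcal F_1,\ldots,F_s\in\mathcal F_s$ such that $F_1,\ldots,F_s$ are pairwise disjoint. *)

theory Defs
  imports Main "HOL-Library.Disjoint_Sets"
begin

(* Disjointness is required of the indexed tuple (A 1, ..., A s): for distinct indices i and j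
   the sets A i and A j must be disjoint, so a repeated member is allowed only if it is empty. *)
definition cross_dependent :: "nat \<Rightarrow> (nat \<Rightarrow> 'a set set) \<Rightarrow> bool" where
  "cross_dependent s \<F> \<longleftrightarrow>
     \<not> (\<exists>A. (\<forall>i\<in>{1..s}. A i \<in> \<F> i) \<and> disjoint_family_on A {1..s})"

end

theory Submission
  imports Defs Complex_Main
begin

text \<open>
  Give a set \<open>S \<subseteq> V\<close> the weight \<open>1 / (card V choose card S)\<close>, so that a full level has weight 1.
  Fix sizes \<open>a\<^sub>1, \<dots>, a\<^sub>s\<close> with sum \<open>a\<close>. If the families are cross-dependent on \<open>V\<close>, then the sets
  missing from \<open>\<F>\<^sub>i\<close> with sizes between \<open>a\<^sub>i\<close> and \<open>card V - (a - a\<^sub>i)\<close> have total weight at least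
  \<open>card V + 1 - a\<close>. This goes by induction on \<open>card V\<close>: if \<open>a\<^sub>i > 0\<close>, give a random point of \<open>V\<close> to
  the \<open>i\<close>-th family (link) and withhold it from the others (deletion); if all \<open>a\<^sub>i\<close> are 0, some
  \<open>\<F>\<^sub>i\<close> misses the empty set, which contributes 1 and allows \<open>a\<^sub>i\<close> to be raised to 1.

  Taking \<open>a\<^sub>i = j\<close> for all \<open>i\<close>, the levels \<open>j, \<dots>, n - j\<close> carry missing weight at least
  \<open>n + 1 - s j\<close>. Multiplying by \<open>(n choose j) - (n choose (j - 1)) \<ge> 0\<close> and summing over \<open>j \<le> m\<close>
  bounds the number of missing sets from below, since \<open>n choose t\<close> is at least the sum of these
  differences over all \<open>j \<le> m\<close> with \<open>j \<le> t \<le> n - j\<close>.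
\<close>

section \<open>Missing sets and their weights\<close>

text \<open>The bound \<open>b\<close> is on the size of the complement in \<open>V\<close>, which
  avoids truncated subtraction.\<close>

definition missing_sets :: "'a set \<Rightarrow> 'a set set \<Rightarrow> nat \<Rightarrow> nat \<Rightarrow> 'a set set" where
  "missing_sets V F a b = {S \<in> Pow V. S \<notin> F \<and> a \<le> card S \<and> card S + b \<le> card V}"

definition missing_weight :: "'a set \<Rightarrow> 'a set set \<Rightarrow> nat \<Rightarrow> nat \<Rightarrow> real" where
  "missing_weight V F a b = (\<Sum>S\<in>missing_sets V F a b. 1 / real (card V choose card S))"

lemma finite_missing_sets [simp]: "finite V \<Longrightarrow> finite (missing_sets V F a b)"
  by (simp add: missing_sets_def)

lemma missing_weight_nonneg: "missing_weight V F a b \<ge> 0"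
  unfolding missing_weight_def by (intro sum_nonneg) auto

lemma missing_weight_antimono:
  assumes "finite V" "b \<le> b'"
  shows "missing_weight V F a b' \<le> missing_weight V F a b"
  unfolding missing_weight_def using assms
  by (intro sum_mono2) (auto simp: missing_sets_def)

lemma missing_weight_empty_notin:
  assumes "finite V" "{} \<notin> F"
  shows "missing_weight V F 0 0 = 1 + missing_weight V F 1 0"
proof -
  have "missing_sets V F 0 0 = insert {} (missing_sets V F 1 0)"
    using assms by (auto simp: missing_sets_def Suc_le_eq card_gt_0_iff
        intro: card_mono dest: finite_subset)
  moreover have "{} \<notin> missing_sets V F 1 0"
    by (simp add: missing_sets_def)
  ultimately show ?thesis
    using assms(1) by (simp add: missing_weight_def)
qed

section \<open>Averaging over a point of the ground set\<close>

text \<open>A set \<open>S\<close> survives the deletion of each of the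
  \<open>card V - card S\<close> points outside it, and absorption turns this count into the ratio
  of the two weights. Its complement in \<open>V\<close> has one point more than in
  \<open>V - {x}\<close>, hence \<open>Suc b\<close>.\<close>

lemma missing_weight_deletion:
  assumes "finite V"
  shows "(\<Sum>x\<in>V. missing_weight (V - {x}) F a b) = real (card V) * missing_weight V F a (Suc b)"
proof -
  let ?M = "missing_sets V F a (Suc b)"
  let ?w = "\<lambda>S. 1 / real (card V - 1 choose card S)"
  have "missing_weight (V - {x}) F a b = sum ?w {S \<in> ?M. x \<notin> S}" if "x \<in> V" for x
  proof -
    have "missing_sets (V - {x}) F a b = {S \<in> ?M. x \<notin> S}"
      using that assms card_gt_0_iff[of V] by (auto simp: missing_sets_def)
    then show ?thesis
      using that assms by (simp add: missing_weight_def)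
  qed
  then have "(\<Sum>x\<in>V. missing_weight (V - {x}) F a b) = (\<Sum>x\<in>V. sum ?w {S \<in> ?M. x \<notin> S})"
    by simp
  also have "\<dots> = (\<Sum>S\<in>?M. \<Sum>x | x \<in> V \<and> x \<notin> S. ?w S)"
    using assms by (intro sum.swap_restrict) auto
  also have "\<dots> = (\<Sum>S\<in>?M. real (card V) * (1 / real (card V choose card S)))"
  proof (rule sum.cong[OF refl])
    fix S assume S: "S \<in> ?M"
    then have "S \<subseteq> V" and le: "Suc (card S) \<le> card V"
      by (auto simp: missing_sets_def)
    have "{x. x \<in> V \<and> x \<notin> S} = V - S"
      by auto
    then have c: "card {x. x \<in> V \<and> x \<notin> S} = card V - card S"
      using \<open>S \<subseteq> V\<close> assms by (simp add: card_Diff_subset finite_subset)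
    have "(card V - card S) * (card V choose card S) = card V * (card V - 1 choose card S)"
      using binomial_absorb_comp[of "card V" "card S"] by simp
    then have "real (card V - card S) * real (card V choose card S)
        = real (card V) * real (card V - 1 choose card S)"
      by (metis of_nat_mult)
    moreover have "card V choose card S \<noteq> 0" "card V - 1 choose card S \<noteq> 0"
      using le by simp_all
    ultimately show "(\<Sum>x | x \<in> V \<and> x \<notin> S. ?w S) = real (card V) * (1 / real (card V choose card S))"
      by (simp add: c field_simps)
  qed
  finally show ?thesis
    by (simp add: missing_weight_def sum_distrib_left)
qed

text \<open>Inserting \<open>x\<close> turns the missing sets of the link into the missing sets of
  \<open>F\<close> through \<open>x\<close>, so \<open>S\<close> occurs once for each of its points;
  absorption again matches the weights.\<close>

lemma missing_weight_link:
  assumes "finite V"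
  shows "(\<Sum>x\<in>V. missing_weight (V - {x}) {S. insert x S \<in> F} a b)
    = real (card V) * missing_weight V F (Suc a) b"
proof -
  let ?M = "missing_sets V F (Suc a) b"
  let ?w = "\<lambda>S. 1 / real (card V - 1 choose (card S - 1))"
  have "missing_weight (V - {x}) {S. insert x S \<in> F} a b = sum ?w {S \<in> ?M. x \<in> S}" if x: "x \<in> V" for x
    unfolding missing_weight_def
  proof (rule sum.reindex_bij_witness[of _ "\<lambda>S. S - {x}" "insert x"])
    fix S assume S: "S \<in> missing_sets (V - {x}) {S. insert x S \<in> F} a b"
    then have "finite S" "x \<notin> S" "S \<subseteq> V"
      using assms by (auto simp: missing_sets_def intro: finite_subset)
    then show "insert x S - {x} = S" "insert x S \<in> {S \<in> ?M. x \<in> S}"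
      and "1 / real (card V - 1 choose (card (insert x S) - 1))
        = 1 / real (card (V - {x}) choose card S)"
      using S x assms card_gt_0_iff[of V] by (auto simp: missing_sets_def)
  next
    fix S assume S: "S \<in> {S \<in> ?M. x \<in> S}"
    then have "finite S"
      using assms by (auto simp: missing_sets_def intro: finite_subset)
    then show "insert x (S - {x}) = S" "S - {x} \<in> missing_sets (V - {x}) {S. insert x S \<in> F} a b"
      using S x assms by (auto simp: missing_sets_def insert_absorb)
  qed
  then have "(\<Sum>x\<in>V. missing_weight (V - {x}) {S. insert x S \<in> F} a b)
      = (\<Sum>x\<in>V. sum ?w {S \<in> ?M. x \<in> S})"
    by simp
  also have "\<dots> = (\<Sum>S\<in>?M. \<Sum>x | x \<in> V \<and> x \<in> S. ?w S)"
    using assms by (intro sum.swap_restrict) auto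
  also have "\<dots> = (\<Sum>S\<in>?M. real (card V) * (1 / real (card V choose card S)))"
  proof (rule sum.cong[OF refl])
    fix S assume S: "S \<in> ?M"
    then have "S \<subseteq> V" and le: "card S \<le> card V" and pos: "card S > 0"
      by (auto simp: missing_sets_def)
    have c: "{x. x \<in> V \<and> x \<in> S} = S"
      using \<open>S \<subseteq> V\<close> by auto
    have "card S * (card V choose card S) = card V * (card V - 1 choose (card S - 1))"
      using times_binomial_minus1_eq[OF pos] by simp
    then have "real (card S) * real (card V choose card S)
        = real (card V) * real (card V - 1 choose (card S - 1))"
      by (metis of_nat_mult)
    moreover have "card V choose card S \<noteq> 0" "card V - 1 choose (card S - 1) \<noteq> 0"
      using le by (simp_all add: diff_le_mono)
    ultimately show "(\<Sum>x | x \<in> V \<and> x \<in> S. ?w S) = real (card V) * (1 / real (card V choose card S))"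
      by (simp add: c field_simps)
  qed
  finally show ?thesis
    by (simp add: missing_weight_def sum_distrib_left)
qed

section \<open>Lower bound on the missing weight\<close>

text \<open>Testing \<open>A i \<subseteq> V\<close> in the hypothesis lets links and deletions be
  used without cutting the families down to subsets of \<open>V - {x}\<close>.\<close>

lemma sum_missing_weight_ge:
  fixes a :: "'i \<Rightarrow> nat" and F :: "'i \<Rightarrow> 'a set set"
  assumes "finite I" "finite V" "sum a I \<le> card V"
    and "\<And>A. disjoint_family_on A I \<Longrightarrow> \<exists>i\<in>I. \<not> (A i \<subseteq> V \<and> A i \<in> F i)"
  shows "real (card V) + 1 - real (sum a I)
    \<le> (\<Sum>i\<in>I. missing_weight V (F i) (a i) (sum a (I - {i})))"
  using assms(2-4)
proof (induction "card V" arbitrary: V F a rule: less_induct)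
  case less
  note cross = less.prems(3)
  \<comment> \<open>Stated for every \<open>a\<close>, since the all-zero case applies it to a
    second size vector on the same \<open>V\<close>.\<close>
  have positive: "real (card V) + 1 - real (sum a I)
      \<le> (\<Sum>i\<in>I. missing_weight V (F i) (a i) (sum a (I - {i})))"
    if le: "sum a I \<le> card V" and pos: "sum a I > 0" for a
  proof -
    have "\<exists>i\<in>I. a i \<noteq> 0"
      using pos sum.neutral[of I a] by fastforce
    then obtain i where i: "i \<in> I" "a i > 0"
      by blast
    define a' where "a' = a(i := a i - 1)"
    define F' where "F' x = F(i := {S. insert x S \<in> F i})" for x
    have rest: "sum a (I - {i}) = sum a' (I - {i})"
      by (intro sum.cong) (auto simp: a'_def)
    have sum_a: "sum a I = Suc (sum a' I)"
      using i assms(1) rest by (simp add: sum.remove[of I i] a'_def)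
    have sum_k: "sum a (I - {k}) = Suc (sum a' (I - {k}))" if "k \<in> I" "k \<noteq> i" for k
    proof -
      have "sum a (I - {k} - {i}) = sum a' (I - {k} - {i})"
        by (intro sum.cong) (auto simp: a'_def)
      then show ?thesis
        using i that assms(1) by (simp add: sum.remove[of "I - {k}" i] a'_def)
    qed
    \<comment> \<open>Lowering \<open>a i\<close> keeps the upper cutoff of family \<open>i\<close>
      and lowers every other cutoff by one: exactly the shifts of the link and deletion
      lemmas.\<close>
    have avg: "real (card V) * missing_weight V (F k) (a k) (sum a (I - {k}))
        = (\<Sum>x\<in>V. missing_weight (V - {x}) (F' x k) (a' k) (sum a' (I - {k})))" if "k \<in> I" for k
    proof (cases "k = i")
      case True
      have "F' x i = {S. insert x S \<in> F i}" "a' i = a i - 1" "Suc (a i - 1) = a i" for x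
        using i by (simp_all add: F'_def a'_def)
      then show ?thesis
        unfolding True rest
        using missing_weight_link[OF less.prems(1), of "F i" "a i - 1" "sum a' (I - {i})"] by simp
    next
      case False
      then have "F' x k = F k" "a' k = a k" for x
        by (simp_all add: F'_def a'_def)
      then show ?thesis
        unfolding sum_k[OF that False]
        using missing_weight_deletion[OF less.prems(1), of "F k" "a k" "sum a' (I - {k})"] by simp
    qed
    \<comment> \<open>\<open>card V\<close> and \<open>sum a I\<close> both drop by one, so the
      bound does not change.\<close>
    have ih: "real (card V) + 1 - real (sum a I)
        \<le> (\<Sum>k\<in>I. missing_weight (V - {x}) (F' x k) (a' k) (sum a' (I - {k})))" if x: "x \<in> V" for x
    proof -
      have card: "card V = Suc (card (V - {x}))"
        using card_Suc_Diff1[OF less.prems(1) x] by simp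
      have "real (card (V - {x})) + 1 - real (sum a' I)
          \<le> (\<Sum>k\<in>I. missing_weight (V - {x}) (F' x k) (a' k) (sum a' (I - {k})))"
      proof (rule less.hyps)
        show "card (V - {x}) < card V" "finite (V - {x})" "sum a' I \<le> card (V - {x})"
          using card less.prems(1) le sum_a by simp_all
        fix A :: "'i \<Rightarrow> 'a set" assume A: "disjoint_family_on A I"
        show "\<exists>k\<in>I. \<not> (A k \<subseteq> V - {x} \<and> A k \<in> F' x k)"
        proof (rule ccontr)
          assume "\<not> ?thesis"
          then have *: "A k \<subseteq> V - {x}" "A k \<in> F' x k" if "k \<in> I" for k
            using that by auto
          \<comment> \<open>Returning \<open>x\<close> to the \<open>i\<close>-th set keeps
            disjointness, as every \<open>A k\<close> avoids \<open>x\<close>.\<close>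
          define B where "B = A(i := insert x (A i))"
          have "disjoint_family_on B I"
            using A *(1) unfolding disjoint_family_on_def B_def by (auto simp: i)
          moreover have "B k \<subseteq> V \<and> B k \<in> F k" if "k \<in> I" for k
            using *[OF that] x by (auto simp: B_def F'_def split: if_splits)
          ultimately show False
            using cross by blast
        qed
      qed
      then show ?thesis
        using card sum_a by simp
    qed
    have "real (card V) * (real (card V) + 1 - real (sum a I))
        = (\<Sum>x\<in>V. real (card V) + 1 - real (sum a I))"
      by simp
    also have "\<dots> \<le> (\<Sum>x\<in>V. \<Sum>k\<in>I. missing_weight (V - {x}) (F' x k) (a' k) (sum a' (I - {k})))"
      by (intro sum_mono ih)
    also have "\<dots> = (\<Sum>k\<in>I. real (card V) * missing_weight V (F k) (a k) (sum a (I - {k})))"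
      by (subst sum.swap) (simp add: avg)
    also have "\<dots> = real (card V) * (\<Sum>k\<in>I. missing_weight V (F k) (a k) (sum a (I - {k})))"
      by (simp add: sum_distrib_left)
    finally show ?thesis
      using le pos by (simp add: mult_le_cancel_left)
  qed
  show ?case
  proof (cases "sum a I > 0")
    case True
    then show ?thesis
      using positive less.prems(2) by blast
  next
    case False
    then have zero: "a i = 0" if "i \<in> I" for i
      using that assms(1) by simp
    have "disjoint_family_on (\<lambda>_. {}) I"
      by (simp add: disjoint_family_on_def)
    then obtain i where i: "i \<in> I" "{} \<notin> F i"
      using cross by fastforce
    \<comment> \<open>The size of the family missing the empty set is raised to 1. The other windows
      only shrink, so the gain of 1 from the empty set is kept.\<close>
    define e where "e k = (if k = i then 1 else 0 :: nat)" for k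
    let ?W = "\<lambda>a. \<Sum>k\<in>I. missing_weight V (F k) (a k) (sum a (I - {k}))"
    have sum_e: "sum e J = (if i \<in> J then 1 else 0)" if "finite J" for J
      using that by (simp add: e_def)
    have W_a: "?W a = (\<Sum>k\<in>I. missing_weight V (F k) 0 0)"
      using zero by (intro sum.cong) auto
    have "1 + ?W e \<le> ?W a"
    proof -
      have "(\<Sum>k\<in>I - {i}. missing_weight V (F k) (e k) (sum e (I - {k})))
          \<le> (\<Sum>k\<in>I - {i}. missing_weight V (F k) 0 0)"
        using missing_weight_antimono[OF less.prems(1)]
        by (intro sum_mono) (simp add: e_def)
      moreover have "missing_weight V (F i) (e i) (sum e (I - {i})) = missing_weight V (F i) 1 0"
        using assms(1) by (simp add: sum_e) (simp add: e_def)
      ultimately show ?thesis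
        using missing_weight_empty_notin[OF less.prems(1) i(2)] i(1) assms(1)
        by (simp add: W_a sum.remove[of I i])
    qed
    moreover have "real (card V) \<le> ?W e"
    \<comment> \<open>On an empty \<open>V\<close> the sizes \<open>e\<close> do not fit and
      \<open>positive\<close> does not apply, but the bound is 0.\<close>
    proof (cases "card V = 0")
      case True
      then show ?thesis
        by (simp add: sum_nonneg missing_weight_nonneg)
    next
      case False
      then show ?thesis
        using positive[of e] i(1) assms(1) by (simp add: sum_e)
    qed
    ultimately show ?thesis
      using False by simp
  qed
qed

section \<open>Differences of consecutive binomial coefficients\<close>

text \<open>For \<open>j = 0\<close> the lower index -1 must give 0, where truncated subtraction
  would give 1.\<close>

definition binomial_diff :: "nat \<Rightarrow> nat \<Rightarrow> real" where
  "binomial_diff n j = real (n choose j) - (if j = 0 then 0 else real (n choose (j - 1)))"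

lemma binomial_diff_nonneg:
  assumes "2 * j \<le> n"
  shows "binomial_diff n j \<ge> 0"
  using binomial_mono[of "j - 1" j n] assms by (simp add: binomial_diff_def)

lemma sum_binomial_diff: "(\<Sum>j\<le>k. binomial_diff n j) = real (n choose k)"
  by (induction k) (simp_all add: binomial_diff_def)

text \<open>The admissible \<open>j\<close> form an initial segment, so the sum telescopes to one
  coefficient with lower index at most \<open>min t (n - t)\<close>, in the increasing half of the
  row.\<close>

lemma sum_binomial_diff_le:
  assumes "t \<le> n" "2 * m \<le> n"
  shows "(\<Sum>j | j \<le> m \<and> j \<le> t \<and> t + j \<le> n. binomial_diff n j) \<le> real (n choose t)"
proof -
  define k where "k = min m (min t (n - t))"
  have "{j. j \<le> m \<and> j \<le> t \<and> t + j \<le> n} = {..k}"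
    using assms(1) by (auto simp: k_def)
  then have "(\<Sum>j | j \<le> m \<and> j \<le> t \<and> t + j \<le> n. binomial_diff n j) = real (n choose k)"
    by (simp add: sum_binomial_diff)
  also have "n choose k \<le> n choose min t (n - t)"
    by (rule binomial_mono) (auto simp: k_def)
  also have "n choose min t (n - t) = n choose t"
    using binomial_symmetric[OF assms(1)] by (simp add: min_def)
  finally show ?thesis
    by simp
qed

text \<open>Summation by parts: the second factor drops by \<open>s\<close> at each step.\<close>

lemma sum_binomial_diff_times:
  "(\<Sum>j\<le>m. binomial_diff n j * (c - s * real j))
    = (c - s * real m) * real (n choose m) + s * (\<Sum>j<m. real (n choose j))"
  by (induction m) (simp_all add: binomial_diff_def algebra_simps)

section \<open>Counting the missing sets\<close>

theorem theorem1:
  fixes s m l n :: nat and \<F> :: "nat \<Rightarrow> nat set set"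
  assumes "s \<ge> 2"
    and "l \<in> {1..s}"
    and "n = s * m + s - l"
    and "\<And>i. i \<in> {1..s} \<Longrightarrow> \<F> i \<subseteq> Pow {1..n}"
    and "cross_dependent s \<F>"
  shows "(\<Sum>i=1..s. card (\<F> i)) \<le> (l - 1) * (n choose m) + s * (\<Sum>t=m+1..n. n choose t)"
proof -
  let ?V = "{1..n}"
  have n: "n + l = s * m + s" and l: "1 \<le> l" "l \<le> s"
    using assms(2,3) by auto
  have sm: "s * m \<le> n"
    using n l by linarith
  have "2 * m \<le> s * m"
    using assms(1) by simp
  then have m: "2 * m \<le> n"
    using sm by linarith
  have level: "real n + 1 - real s * real j \<le> (\<Sum>i=1..s. missing_weight ?V (\<F> i) j j)"
    if "j \<le> m" for j
  proof -
    have "s * j \<le> n"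
      using that sm by (meson le_trans mult_le_mono2)
    then have "real (card ?V) + 1 - real (\<Sum>i=1..s. j)
        \<le> (\<Sum>i=1..s. missing_weight ?V (\<F> i) j (\<Sum>k\<in>{1..s} - {i}. j))"
      using assms(5) unfolding cross_dependent_def
      by (intro sum_missing_weight_ge) auto
    \<comment> \<open>As \<open>s \<ge> 2\<close>, the cutoff \<open>(s - 1) * j\<close> is at least
      \<open>j\<close>, so the window may be widened to a symmetric one.\<close>
    also have "\<dots> \<le> (\<Sum>i=1..s. missing_weight ?V (\<F> i) j j)"
      using assms(1) by (intro sum_mono missing_weight_antimono) auto
    finally show ?thesis
      by simp
  qed
  have family: "(\<Sum>j\<le>m. binomial_diff n j * missing_weight ?V (\<F> i) j j) \<le> 2 ^ n - real (card (\<F> i))"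
    if i: "i \<in> {1..s}" for i
  proof -
    let ?M = "Pow ?V - \<F> i"
    have "(\<Sum>j\<le>m. binomial_diff n j * missing_weight ?V (\<F> i) j j)
      = (\<Sum>j\<in>{..m}. \<Sum>S | S \<in> ?M \<and> (j \<le> card S \<and> card S + j \<le> n).
          binomial_diff n j / real (n choose card S))"
      unfolding missing_weight_def sum_distrib_left
      by (intro sum.cong) (auto simp: missing_sets_def)
    \<comment> \<open>After the exchange each missing set is charged at most 1 in total, so the sum
      is at most the number of missing sets.\<close>
    also have "\<dots> = (\<Sum>S\<in>?M. \<Sum>j | j \<in> {..m} \<and> (j \<le> card S \<and> card S + j \<le> n).
          binomial_diff n j / real (n choose card S))"
      by (intro sum.swap_restrict) auto
    also have "\<dots> \<le> (\<Sum>S\<in>?M. 1)"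
    proof (rule sum_mono)
      fix S assume "S \<in> ?M"
      then have S: "card S \<le> n"
        using card_mono[of ?V S] by simp
      then have "real (n choose card S) > 0"
        by simp
      then show "(\<Sum>j | j \<in> {..m} \<and> (j \<le> card S \<and> card S + j \<le> n).
          binomial_diff n j / real (n choose card S)) \<le> 1"
        using sum_binomial_diff_le[OF S m]
        by (simp add: sum_divide_distrib[symmetric])
    qed
    also have "\<dots> = real (2 ^ n - card (\<F> i))"
      using assms(4)[OF i] by (simp add: card_Diff_subset finite_subset card_Pow)
    also have "\<dots> = 2 ^ n - real (card (\<F> i))"
      using card_mono[OF _ assms(4)[OF i]] by (simp add: of_nat_diff card_Pow)
    finally show ?thesis .
  qed
  \<comment> \<open>The boundary factor \<open>n + 1 - s * m\<close> of the summation by parts is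
    \<open>s - l + 1\<close>.\<close>
  have "real (s - l + 1) * real (n choose m) + real s * (\<Sum>t<m. real (n choose t))
      = (real n + 1 - real s * real m) * real (n choose m) + real s * (\<Sum>t<m. real (n choose t))"
  proof -
    have "real n + real l = real s * real m + real s"
      using n by (metis of_nat_add of_nat_mult)
    then show ?thesis
      using l by (simp add: of_nat_diff)
  qed
  also have "\<dots> = (\<Sum>j\<le>m. binomial_diff n j * (real n + 1 - real s * real j))"
    by (simp add: sum_binomial_diff_times)
  also have "\<dots> \<le> (\<Sum>j\<le>m. binomial_diff n j * (\<Sum>i=1..s. missing_weight ?V (\<F> i) j j))"
    using m by (intro sum_mono mult_left_mono level binomial_diff_nonneg) auto
  also have "\<dots> = (\<Sum>i=1..s. \<Sum>j\<le>m. binomial_diff n j * missing_weight ?V (\<F> i) j j)"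
    unfolding sum_distrib_left by (rule sum.swap)
  also have "\<dots> \<le> (\<Sum>i=1..s. 2 ^ n - real (card (\<F> i)))"
    by (intro sum_mono family)
  also have "\<dots> = real s * 2 ^ n - real (\<Sum>i=1..s. card (\<F> i))"
    by (simp add: sum_subtractf)
  finally have "real (s - l + 1) * real (n choose m) + real s * (\<Sum>t<m. real (n choose t))
      + real (\<Sum>i=1..s. card (\<F> i)) \<le> real s * 2 ^ n"
    by linarith
  then have "real ((s - l + 1) * (n choose m) + s * (\<Sum>t<m. n choose t) + (\<Sum>i=1..s. card (\<F> i)))
      \<le> real (s * 2 ^ n)"
    by (simp add: distrib_right)
  then have upper: "(s - l + 1) * (n choose m) + s * (\<Sum>t<m. n choose t) + (\<Sum>i=1..s. card (\<F> i))
      \<le> s * 2 ^ n"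
    by (simp only: of_nat_le_iff)
  \<comment> \<open>Subtracting the missing sets from \<open>s\<close> full rows leaves the
    coefficient \<open>s - (s - l + 1) = l - 1\<close> at level \<open>m\<close> and
    \<open>s\<close> above it.\<close>
  have "{..n} = {..<m} \<union> {m} \<union> {m+1..n}"
    using m by auto
  then have "(\<Sum>t\<le>n. n choose t) = (\<Sum>t<m. n choose t) + (n choose m) + (\<Sum>t=m+1..n. n choose t)"
    by (auto intro!: sum.union_disjoint)
  then have "2 ^ n = (\<Sum>t<m. n choose t) + (n choose m) + (\<Sum>t=m+1..n. n choose t)"
    by (simp only: choose_row_sum)
  then have "s * 2 ^ n = s * (\<Sum>t<m. n choose t) + s * (n choose m) + s * (\<Sum>t=m+1..n. n choose t)"
    by (simp add: distrib_left)
  moreover have "s * (n choose m) = (s - l + 1) * (n choose m) + (l - 1) * (n choose m)"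
    using l by (subst distrib_right[symmetric]) simp
  ultimately show ?thesis
    using upper by linarith
qed

end
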